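(* Let $n\ge 0$ be an integer and $\Pi_n=\mathbb{Z}[X_1,\ldots,X_n]$. Every non-zero polynomial $M\in\Pi_n$ has a unique factorization into primes $$M=\operatorname{sgn}(M)\prod_{p\in\mathcal{P}_n}p^{\nu_p(M)},$$ where the multiplicities $\nu_p(M)\in\mathbb{N}$ of $p$ in $M$ are natural numbers, all but finitely many of which are zero.
   Context: $\Pi_0=\mathbb{Z}$ and $\Pi_n=\Pi_{n-1}[X_n]$ for $n>0$. Positivity in $\Pi_n$ is defined recursively: for $n=0$, $P\in\mathbb{Z}$ is positive if $P>0$ in the usual order; for $n>0$, a non-zero $P=\sum_{i=0}^d P_iX_n^{d-i}$ with $P_i\in\Pi_{n-1}$, $P_0\neq 0$, is positive if its leading coefficient $P_0$ is positive in $\Pi_{n-1}$. $P$ is negative if $-P$ is positive. Every non-zero element is either positive or negative; $\operatorname{sgn}(M)=1$ if $M$ is positive, $-1$ if $M$ is negative (and $0$ if $M=0$). The units of $\Pi_n$ are $\{-1,1\}$. A polynomial $P\in\Pi_n$ is irreducible if it is not a unit and whenever $P=UV$ with $U,V\in\Pi_n$, either $U$ or $V$ is a unit. A prime polynomial is a positive irreducible polynomial; $\mathcal{P}_n$ is the set of prime polynomials of $\Pi_n$. *)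

theory Defs
  imports "HOL-Library.Poly_Mapping"
begin

text \<open>
  Integer polynomials in countably many variables: a monomial is a finitely supported exponent
  vector, a polynomial a finitely supported coefficient function on monomials; sum and product
  are those of \<^theory>\<open>HOL-Library.Poly_Mapping\<close> (the product is convolution).  All the rings
  \<open>\<Pi>\<^sub>n\<close> then live in a single type, so that \<open>n\<close> can vary.
\<close>

type_synonym ipoly = "(nat \<Rightarrow>\<^sub>0 nat) \<Rightarrow>\<^sub>0 int"

definition X :: "nat \<Rightarrow> ipoly" where
  "X i = Poly_Mapping.single (Poly_Mapping.single i 1) 1"

definition PI :: "nat \<Rightarrow> ipoly set" where
  "PI n = {P. \<forall>m \<in> Poly_Mapping.keys P. Poly_Mapping.keys m \<subseteq> {1..n}}"

lemma PI_0: "PI 0 = range of_int"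
proof (intro set_eqI iffI)
  fix P :: ipoly assume "P \<in> PI 0"
  then have "Poly_Mapping.keys P \<subseteq> {0}"
    by (auto simp: PI_def)
  then have "P = Poly_Mapping.single 0 (Poly_Mapping.lookup P 0)"
    by (intro poly_mapping_eqI) (auto simp: lookup_single when_def in_keys_iff)
  also have "\<dots> = of_int (Poly_Mapping.lookup P 0)"
    by (cases "Poly_Mapping.lookup P 0 :: int")
       (simp_all flip: of_nat_single add: single_uminus single_diff single_one del: of_nat_Suc)
  finally show "P \<in> range of_int" by (rule range_eqI)
next
  fix P :: ipoly assume "P \<in> range of_int"
  then obtain a where a: "P = of_int a" by blast
  have "Poly_Mapping.lookup P m = (if m = 0 then a else 0)" for m
    unfolding a by (cases a rule: int_diff_cases) (auto simp: lookup_minus lookup_of_nat when_def)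
  then have "Poly_Mapping.keys P \<subseteq> {0}"
    by (auto simp: in_keys_iff split: if_splits)
  then show "P \<in> PI 0" by (auto simp: PI_def)
qed

lemma X_power: "X i ^ k = Poly_Mapping.single (Poly_Mapping.single i k) 1"
  by (induction k) (simp_all add: X_def mult_single single_one flip: single_add)

lemma zero_in_PI: "0 \<in> PI n"
  and one_in_PI: "1 \<in> PI n"
  and X_in_PI: "1 \<le> i \<Longrightarrow> i \<le> n \<Longrightarrow> X i \<in> PI n"
  by (auto simp: PI_def X_def)

lemma uminus_in_PI: "P \<in> PI n \<Longrightarrow> - P \<in> PI n"
  by (simp add: PI_def)

lemma add_in_PI: "P \<in> PI n \<Longrightarrow> Q \<in> PI n \<Longrightarrow> P + Q \<in> PI n"
  using keys_add[of P Q] by (fastforce simp: PI_def)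

lemma mult_in_PI: assumes "P \<in> PI n" "Q \<in> PI n" shows "P * Q \<in> PI n"
  unfolding PI_def
proof safe
  fix m i assume "m \<in> Poly_Mapping.keys (P * Q)" and i: "i \<in> Poly_Mapping.keys m"
  then obtain a b where ab: "m = a + b" "a \<in> Poly_Mapping.keys P" "b \<in> Poly_Mapping.keys Q"
    using keys_mult[of P Q] by blast
  then have "i \<in> Poly_Mapping.keys a \<union> Poly_Mapping.keys b"
    using i keys_add[of a b] by blast
  then show "i \<in> {1..n}"
    using assms ab(2,3) unfolding PI_def by blast
qed

lemma power_in_PI: "P \<in> PI n \<Longrightarrow> P ^ k \<in> PI n"
  by (induction k) (auto simp: one_in_PI mult_in_PI)

lemma sum_in_PI: "(\<And>a. a \<in> A \<Longrightarrow> f a \<in> PI n) \<Longrightarrow> sum f A \<in> PI n"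
  by (induction A rule: infinite_finite_induct) (auto simp: zero_in_PI add_in_PI)

lemma PI_mono: "n \<le> n' \<Longrightarrow> PI n \<subseteq> PI n'"
  by (fastforce simp: PI_def)

lemma PI_Suc:
  "PI (Suc n) = {\<Sum>i\<le>d. c i * X (Suc n) ^ (d - i) |d c. \<forall>i\<le>d. c i \<in> PI n}" (is "_ = ?R")
proof (intro set_eqI iffI)
  fix P :: ipoly assume P: "P \<in> PI (Suc n)"
  define K where "K = Poly_Mapping.keys P"
  define e where "e m = Poly_Mapping.lookup m (Suc n)" for m :: "nat \<Rightarrow>\<^sub>0 nat"
  define d where "d = (\<Sum>m\<in>K. e m)"
  define c where "c i = (\<Sum>m\<in>{m \<in> K. d - e m = i}.
      Poly_Mapping.single (m - Poly_Mapping.single (Suc n) (e m)) (Poly_Mapping.lookup P m))" for i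
  have fin: "finite K" by (simp add: K_def)
  have le: "e m \<le> d" if "m \<in> K" for m
    unfolding d_def using that fin by (intro member_le_sum) auto
  have split: "m - Poly_Mapping.single (Suc n) (e m) + Poly_Mapping.single (Suc n) (e m) = m" for m
    by (intro poly_mapping_eqI) (auto simp: lookup_add lookup_minus lookup_single when_def e_def)
  have "Poly_Mapping.keys (m - Poly_Mapping.single (Suc n) (e m)) \<subseteq> {1..n}" if m: "m \<in> K" for m
  proof
    fix i assume "i \<in> Poly_Mapping.keys (m - Poly_Mapping.single (Suc n) (e m))"
    then have "i \<in> Poly_Mapping.keys m" "i \<noteq> Suc n"
      by (auto simp: in_keys_iff lookup_minus lookup_single when_def e_def split: if_splits)
    moreover have "Poly_Mapping.keys m \<subseteq> {1..Suc n}"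
      using P m by (auto simp: PI_def K_def)
    ultimately show "i \<in> {1..n}" by (auto simp: le_Suc_eq)
  qed
  then have c: "\<forall>i\<le>d. c i \<in> PI n"
    unfolding c_def by (intro allI impI sum_in_PI) (auto simp: PI_def)
  have "(\<Sum>i\<le>d. c i * X (Suc n) ^ (d - i))
      = (\<Sum>i\<le>d. \<Sum>m\<in>{m \<in> K. d - e m = i}. Poly_Mapping.single m (Poly_Mapping.lookup P m))"
    unfolding c_def sum_distrib_right
    by (intro sum.cong refl) (auto simp: X_power mult_single split dest: le)
  also have "\<dots> = (\<Sum>m\<in>K. Poly_Mapping.single m (Poly_Mapping.lookup P m))"
    using fin by (intro sum.group) auto
  also have "\<dots> = P"
    by (intro poly_mapping_eqI)
       (auto simp: lookup_sum lookup_single when_def fin K_def in_keys_iff)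
  finally show "P \<in> ?R" using c by blast
next
  fix P :: ipoly assume "P \<in> ?R"
  then show "P \<in> PI (Suc n)"
    using PI_mono[of n "Suc n"]
    by (fastforce intro!: sum_in_PI mult_in_PI power_in_PI X_in_PI)
qed

fun positive :: "nat \<Rightarrow> ipoly \<Rightarrow> bool" where
  "positive 0 P \<longleftrightarrow> (\<exists>a::int. P = of_int a \<and> a > 0)"
| "positive (Suc n) P \<longleftrightarrow>
     (\<exists>d c. (\<forall>i\<le>d. c i \<in> PI n) \<and> P = (\<Sum>i\<le>d. c i * X (Suc n) ^ (d - i)) \<and>
            c 0 \<noteq> 0 \<and> positive n (c 0))"

definition negative :: "nat \<Rightarrow> ipoly \<Rightarrow> bool" where
  "negative n P \<longleftrightarrow> positive n (- P)"

definition sign :: "nat \<Rightarrow> ipoly \<Rightarrow> int" where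
  "sign n M = (if positive n M then 1 else if negative n M then - 1 else 0)"

definition unit_in_PI :: "nat \<Rightarrow> ipoly \<Rightarrow> bool" where
  "unit_in_PI n U \<longleftrightarrow> U \<in> PI n \<and> (\<exists>V \<in> PI n. U * V = 1)"

definition irreducible_in_PI :: "nat \<Rightarrow> ipoly \<Rightarrow> bool" where
  "irreducible_in_PI n P \<longleftrightarrow> P \<in> PI n \<and> \<not> unit_in_PI n P \<and>
     (\<forall>U \<in> PI n. \<forall>V \<in> PI n. P = U * V \<longrightarrow> unit_in_PI n U \<or> unit_in_PI n V)"

definition prime_polys :: "nat \<Rightarrow> ipoly set" where
  "prime_polys n = {P. positive n P \<and> irreducible_in_PI n P}"

end

theory Submission
  imports Defs "HOL-Computational_Algebra.Polynomial" "HOL-Computational_Algebra.Primes"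
begin

text \<open>
  By induction on \<open>n\<close>, \<^term>\<open>PI n\<close> is a unique factorization domain with units \<open>1\<close> and \<open>-1\<close>;
  choosing the positive one among the two associates of each irreducible then makes the
  factorization of \<open>M\<close> literally unique and forces its unit to be the sign of \<open>M\<close>.

  The rings \<^term>\<open>PI n\<close> are subsets of one type, so unique factorization is formulated for a
  subset \<open>R\<close> of an integral domain (\<open>factorial_subring\<close>): \<open>R\<close> is a subring, its irreducible
  elements are prime, and it carries an additive length that vanishes exactly on the units.
  The length gives existence of factorizations, primality gives uniqueness.

  The heart is Gauss's theorem \<open>factorial_polys_over\<close>, proved without a field of fractions.
  Irreducible constants remain prime in \<open>R[x]\<close> by the usual look at the first coefficients not
  divisible by them (\<open>gauss_const_prime\<close>).  Hence a nonzero constant can be cancelled from an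
  equation \<open>c P = Q D\<close> by distributing its prime factors over \<open>Q\<close> and \<open>D\<close>
  (\<open>gauss_cancel_const\<close>).  If an irreducible \<open>P\<close> of positive degree divides \<open>F G\<close>, take \<open>D\<close> of
  least degree among the nonzero combinations \<open>U P + V F\<close>; pseudo-division shows that \<open>D\<close>
  divides constant multiples of both \<open>P\<close> and \<open>F\<close>.  As \<open>P\<close> is irreducible, \<open>D\<close> is up to constants
  either \<open>P\<close>, whence \<open>P\<close> divides \<open>F\<close>, or a unit, whence \<open>P\<close> divides \<open>G\<close>
  (\<open>gauss_irreducible_prime\<close>).

  Evaluation at \<open>X (Suc n)\<close> identifies the univariate polynomials over \<^term>\<open>PI n\<close> with
  \<^term>\<open>PI (Suc n)\<close> (\<open>inj_on_eval_last\<close>, \<open>PI_Suc_image\<close>).  Under this identification positivity is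
  positivity of the leading coefficient (\<open>positive_eval_last\<close>), so that it is multiplicative
  and selects exactly one of \<open>P\<close> and \<open>-P\<close>.
\<close>

section \<open>Subrings in which irreducible elements are prime\<close>

definition subring :: "'a::idom set \<Rightarrow> bool" where
  "subring R \<longleftrightarrow> 0 \<in> R \<and> 1 \<in> R \<and> (\<forall>a\<in>R. - a \<in> R) \<and>
     (\<forall>a\<in>R. \<forall>b\<in>R. a + b \<in> R \<and> a * b \<in> R)"

definition dvd_in :: "'a::idom set \<Rightarrow> 'a \<Rightarrow> 'a \<Rightarrow> bool" where
  "dvd_in R a b \<longleftrightarrow> (\<exists>c\<in>R. b = a * c)"

definition unit_in :: "'a::idom set \<Rightarrow> 'a \<Rightarrow> bool" where
  "unit_in R u \<longleftrightarrow> u \<in> R \<and> (\<exists>v\<in>R. u * v = 1)"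

definition irreducible_in :: "'a::idom set \<Rightarrow> 'a \<Rightarrow> bool" where
  "irreducible_in R p \<longleftrightarrow> p \<in> R \<and> \<not> unit_in R p \<and>
     (\<forall>u\<in>R. \<forall>v\<in>R. p = u * v \<longrightarrow> unit_in R u \<or> unit_in R v)"

text \<open>
  Additivity makes both factors of a product of non-units strictly shorter than the product.
  An explicit length is kept, rather than a chain condition, because it extends to
  polynomials by adding the degree.
\<close>
definition length_on :: "'a::idom set \<Rightarrow> ('a \<Rightarrow> nat) \<Rightarrow> bool" where
  "length_on R N \<longleftrightarrow> (\<forall>a\<in>R - {0}. \<forall>b\<in>R - {0}. N (a * b) = N a + N b) \<and>
     (\<forall>a\<in>R - {0}. N a = 0 \<longleftrightarrow> unit_in R a)"

definition factorial_subring :: "'a::idom set \<Rightarrow> bool" where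
  "factorial_subring R \<longleftrightarrow> subring R \<and> (\<exists>N. length_on R N) \<and>
     (\<forall>p a b. irreducible_in R p \<longrightarrow> a \<in> R \<longrightarrow> b \<in> R \<longrightarrow> dvd_in R p (a * b) \<longrightarrow>
        dvd_in R p a \<or> dvd_in R p b)"

lemma factorial_subringD:
  assumes "factorial_subring R"
  shows "subring R" "\<exists>N. length_on R N"
    and "irreducible_in R p \<Longrightarrow> a \<in> R \<Longrightarrow> b \<in> R \<Longrightarrow> dvd_in R p (a * b) \<Longrightarrow>
           dvd_in R p a \<or> dvd_in R p b"
  using assms unfolding factorial_subring_def by blast+

lemma subringD:
  assumes "subring R"
  shows "0 \<in> R" "1 \<in> R" "a \<in> R \<Longrightarrow> - a \<in> R"
    "a \<in> R \<Longrightarrow> b \<in> R \<Longrightarrow> a + b \<in> R" "a \<in> R \<Longrightarrow> b \<in> R \<Longrightarrow> a * b \<in> R"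
    "a \<in> R \<Longrightarrow> b \<in> R \<Longrightarrow> a - b \<in> R"
  using assms unfolding subring_def by (auto simp: diff_conv_add_uminus simp del: add_uminus_conv_diff)

lemma subring_sum: "subring R \<Longrightarrow> (\<And>i. i \<in> I \<Longrightarrow> f i \<in> R) \<Longrightarrow> sum f I \<in> R"
  by (induction I rule: infinite_finite_induct) (auto simp: subringD)

lemma subring_prod_mset: "subring R \<Longrightarrow> (\<And>p. p \<in># A \<Longrightarrow> p \<in> R) \<Longrightarrow> prod_mset A \<in> R"
  by (induction A) (auto simp: subringD)

lemma irreducible_in_nonzero: "subring R \<Longrightarrow> irreducible_in R p \<Longrightarrow> p \<noteq> 0"
  unfolding irreducible_in_def by (metis mult_zero_left subringD(1))

lemma unit_in_mult: "subring R \<Longrightarrow> unit_in R u \<Longrightarrow> unit_in R v \<Longrightarrow> unit_in R (u * v)"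
proof -
  assume R: "subring R" and "unit_in R u" "unit_in R v"
  then obtain u' v' where "u \<in> R" "v \<in> R" "u' \<in> R" "v' \<in> R" "u * u' = 1" "v * v' = 1"
    unfolding unit_in_def by blast
  moreover from this have "(u * v) * (u' * v') = 1"
    by (metis mult.assoc mult.left_commute mult_1_right)
  ultimately show ?thesis unfolding unit_in_def using R by (meson subringD(5))
qed

lemma dvd_in_add: "subring R \<Longrightarrow> dvd_in R p a \<Longrightarrow> dvd_in R p b \<Longrightarrow> dvd_in R p (a + b)"
  unfolding dvd_in_def by (metis distrib_left subringD(4))

lemma dvd_in_diff: "subring R \<Longrightarrow> dvd_in R p a \<Longrightarrow> dvd_in R p b \<Longrightarrow> dvd_in R p (a - b)"
  unfolding dvd_in_def by (metis right_diff_distrib subringD(6))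

lemma dvd_in_mult: "subring R \<Longrightarrow> dvd_in R p a \<Longrightarrow> b \<in> R \<Longrightarrow> dvd_in R p (a * b)"
  unfolding dvd_in_def by (metis mult.assoc subringD(5))

lemma dvd_in_sum:
  "subring R \<Longrightarrow> (\<And>i. i \<in> I \<Longrightarrow> dvd_in R p (f i)) \<Longrightarrow> dvd_in R p (sum f I)"
  by (induction I rule: infinite_finite_induct)
     (auto simp: dvd_in_add, auto simp: dvd_in_def intro!: bexI[of _ 0] subringD)

lemma irreducible_factorization_exists:
  assumes R: "factorial_subring R" and a: "a \<in> R" "a \<noteq> 0"
  shows "\<exists>u A. unit_in R u \<and> (\<forall>p\<in>#A. irreducible_in R p) \<and> a = u * prod_mset A"
proof -
  note sub = factorial_subringD(1)[OF R]
  obtain N where N: "length_on R N" using factorial_subringD(2)[OF R] by blast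
  from a show ?thesis
  proof (induction "N a" arbitrary: a rule: less_induct)
    case less
    show ?case
    proof (cases "unit_in R a")
      case True
      then show ?thesis by (intro exI[of _ a] exI[of _ "{#}"]) auto
    next
      case nonunit: False
      show ?thesis
      proof (cases "irreducible_in R a")
        case True
        have "unit_in R 1" using subringD(2)[OF sub] by (auto simp: unit_in_def)
        then show ?thesis using True by (intro exI[of _ 1] exI[of _ "{#a#}"]) auto
      next
        case False
        then obtain b c where bc: "b \<in> R" "c \<in> R" "a = b * c" "\<not> unit_in R b" "\<not> unit_in R c"
          using nonunit less.prems by (auto simp: irreducible_in_def)
        then have nz: "b \<noteq> 0" "c \<noteq> 0" using less.prems by auto
        have "N a = N b + N c" "N b \<noteq> 0" "N c \<noteq> 0"
          using N bc nz unfolding length_on_def by auto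
        then have "N b < N a" "N c < N a" by auto
        then obtain u A v B where
          "unit_in R u" "\<forall>p\<in>#A. irreducible_in R p" "b = u * prod_mset A"
          "unit_in R v" "\<forall>p\<in>#B. irreducible_in R p" "c = v * prod_mset B"
          using less.hyps[of b] less.hyps[of c] bc nz by blast
        then show ?thesis using bc(3)
          by (intro exI[of _ "u * v"] exI[of _ "A + B"])
             (auto simp: unit_in_mult[OF sub] mult_ac)
      qed
    qed
  qed
qed

lemma irreducible_dvd_prod_mset:
  assumes R: "factorial_subring R" and q: "irreducible_in R q"
    and A: "\<And>p. p \<in># A \<Longrightarrow> p \<in> R" and dvd: "dvd_in R q (prod_mset A)"
  shows "\<exists>p\<in>#A. dvd_in R q p"
  using A dvd
proof (induction A)
  case empty
  then have "unit_in R q" using q unfolding dvd_in_def unit_in_def irreducible_in_def by auto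
  then show ?case using q by (simp add: irreducible_in_def)
next
  case (add x A)
  have "prod_mset A \<in> R"
    using add.prems by (intro subring_prod_mset factorial_subringD(1)[OF R]) auto
  then have "dvd_in R q x \<or> dvd_in R q (prod_mset A)"
    using factorial_subringD(3)[OF R q, of x "prod_mset A"] add.prems by auto
  then show ?case using add by auto
qed

text \<open>
  Inside a system of representatives of irreducibles up to units, divisibility between two
  elements is equality, so a common prime can be struck off both sides.
\<close>
lemma irreducible_multiset_unique:
  assumes R: "factorial_subring R"
    and S: "\<And>p. p \<in> S \<Longrightarrow> irreducible_in R p"
    and rep: "\<And>p q u. p \<in> S \<Longrightarrow> q \<in> S \<Longrightarrow> unit_in R u \<Longrightarrow> p = q * u \<Longrightarrow> p = q"
    and AB: "set_mset A \<subseteq> S" "set_mset B \<subseteq> S" "prod_mset A = prod_mset B"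
  shows "A = B"
  using AB
proof (induction A arbitrary: B)
  note sub = factorial_subringD(1)[OF R]
  note S' = S[unfolded irreducible_in_def]
  case empty
  show ?case
  proof (cases B)
    case (add q B')
    then have "q \<in> S" "prod_mset B' \<in> R" "q * prod_mset B' = 1"
      using empty S' by (auto intro!: subring_prod_mset sub)
    then show ?thesis using S' by (auto simp: unit_in_def)
  qed simp
next
  note sub = factorial_subringD(1)[OF R]
  note S' = S[unfolded irreducible_in_def]
  case (add q A)
  have q: "q \<in> S" and "prod_mset A \<in> R"
    using add.prems S' by (auto intro!: subring_prod_mset sub)
  then have "dvd_in R q (prod_mset B)"
    using add.prems(3)[symmetric] by (auto simp: dvd_in_def)
  then obtain p where p: "p \<in># B" "dvd_in R q p"
    using irreducible_dvd_prod_mset[OF R S[OF q], of B] add.prems(2) S' by blast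
  then have pS: "p \<in> S" using add.prems by auto
  from p(2) obtain c where c: "c \<in> R" "p = q * c" by (auto simp: dvd_in_def)
  then have "unit_in R c" using S'[OF pS] S'[OF q] by blast
  then have "p = q" using rep[OF pS q] c by blast
  with p obtain B' where B': "B = add_mset q B'" by (metis insert_DiffM)
  have "q \<noteq> 0" using irreducible_in_nonzero[OF sub S[OF q]] .
  then have "prod_mset A = prod_mset B'" using add.prems(3) B' by simp
  then show ?case using add B' by auto
qed

text \<open>
  Being factorial is an isomorphism invariant.  The homomorphism laws are required on \<open>R\<close> only;
  \<open>R\<close> will be \<open>\<int>\<close>, or polynomials over \<^term>\<open>PI n\<close>, for which injectivity holds only on a subset
  of the type.
\<close>
lemma factorial_subring_image:
  fixes h :: "'a::idom \<Rightarrow> 'b::idom"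
  assumes R: "factorial_subring R" and inj: "inj_on h R"
    and add: "\<And>a b. a \<in> R \<Longrightarrow> b \<in> R \<Longrightarrow> h (a + b) = h a + h b"
    and mult: "\<And>a b. a \<in> R \<Longrightarrow> b \<in> R \<Longrightarrow> h (a * b) = h a * h b"
    and one: "h 1 = 1"
  shows "factorial_subring (h ` R)"
    and unit_in_image: "a \<in> R \<Longrightarrow> unit_in (h ` R) (h a) \<longleftrightarrow> unit_in R a"
proof -
  note sub = factorial_subringD(1)[OF R]
  note cl = subringD[OF sub]
  have "h 0 + h 0 = h 0 + 0" using add[OF cl(1) cl(1)] by (simp only: add_0_right)
  then have zero: "h 0 = 0" by (simp only: add_left_cancel)
  have neg: "h (- a) = - h a" if "a \<in> R" for a
    using add[of a "- a"] that cl(3)[OF that] zero by (simp add: eq_neg_iff_add_eq_0 add.commute)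
  have eq: "h a = h b \<longleftrightarrow> a = b" if "a \<in> R" "b \<in> R" for a b
    using inj that by (auto dest: inj_onD)
  have mult_eq: "h c = h a * h b \<longleftrightarrow> c = a * b" if "a \<in> R" "b \<in> R" "c \<in> R" for a b c
    using that by (simp add: eq cl flip: mult)
  show unit: "unit_in (h ` R) (h a) \<longleftrightarrow> unit_in R a" if "a \<in> R" for a
  proof -
    have "h a * h v = 1 \<longleftrightarrow> a * v = 1" if "v \<in> R" for v
      using mult_eq[OF \<open>a \<in> R\<close> that cl(2)] one by metis
    then show ?thesis using that eq[OF that] by (auto simp: unit_in_def)
  qed
  have dvd: "dvd_in (h ` R) (h a) (h b) \<longleftrightarrow> dvd_in R a b" if "a \<in> R" "b \<in> R" for a b
    using that by (auto simp: dvd_in_def mult_eq)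
  have irr: "irreducible_in R a" if "a \<in> R" "irreducible_in (h ` R) (h a)" for a
    using that by (auto simp: irreducible_in_def unit mult_eq)
  have subimg: "subring (h ` R)"
    unfolding subring_def
  proof (intro conjI ballI)
    show "0 \<in> h ` R" "1 \<in> h ` R" using zero one cl by (metis imageI)+
    fix x assume "x \<in> h ` R"
    then obtain a where a: "a \<in> R" "x = h a" by blast
    then show "- x \<in> h ` R" using neg cl by (metis imageI)
    fix y assume "y \<in> h ` R"
    then obtain b where b: "b \<in> R" "y = h b" by blast
    show "x + y \<in> h ` R" "x * y \<in> h ` R"
      using a b add mult cl by (metis imageI)+
  qed
  obtain N where N: "length_on R N" using factorial_subringD(2)[OF R] by blast
  have "length_on (h ` R) (N \<circ> inv_into R h)"
    unfolding length_on_def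
  proof (intro conjI ballI)
    fix x y assume "x \<in> h ` R - {0}" "y \<in> h ` R - {0}"
    then obtain a b where ab: "a \<in> R - {0}" "x = h a" "b \<in> R - {0}" "y = h b"
      using zero by blast
    have "N (a * b) = N a + N b" using N ab unfolding length_on_def by blast
    then show "(N \<circ> inv_into R h) (x * y) = (N \<circ> inv_into R h) x + (N \<circ> inv_into R h) y"
      using inj ab cl by (simp flip: mult)
    show "(N \<circ> inv_into R h) x = 0 \<longleftrightarrow> unit_in (h ` R) x"
      using N ab inj unfolding length_on_def by (simp add: unit)
  qed
  moreover have "dvd_in (h ` R) p a \<or> dvd_in (h ` R) p b"
    if "irreducible_in (h ` R) p" "a \<in> h ` R" "b \<in> h ` R" "dvd_in (h ` R) p (a * b)" for p a b
  proof -
    from that(1) have "p \<in> h ` R" by (simp add: irreducible_in_def)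
    with that(2,3) obtain p' a' b' where *: "p = h p'" "a = h a'" "b = h b'"
      and R': "p' \<in> R" "a' \<in> R" "b' \<in> R" by blast
    show ?thesis
      using that factorial_subringD(3)[OF R, of p' a' b'] R' irr[of p']
      by (simp add: * dvd cl flip: mult)
  qed
  ultimately show "factorial_subring (h ` R)"
    unfolding factorial_subring_def using subimg by blast
qed

lemma factorial_subring_int: "factorial_subring (UNIV :: int set)"
proof -
  have unit: "unit_in UNIV a \<longleftrightarrow> is_unit a" for a :: int
    by (auto simp: unit_in_def dvd_def eq_commute[of 1])
  have dvd: "dvd_in UNIV a b \<longleftrightarrow> a dvd b" for a b :: int by (auto simp: dvd_in_def dvd_def)
  have sub: "subring (UNIV :: int set)" by (simp add: subring_def)
  have "length_on UNIV (\<lambda>a::int. size (prime_factorization a))"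
    by (auto simp: length_on_def unit prime_factorization_mult prime_factorization_empty_iff)
  moreover have "prime_elem p" if "irreducible_in UNIV p" for p :: int
    using that irreducible_in_nonzero[OF sub that]
    by (intro irreducible_imp_prime_elem) (auto simp: irreducible_in_def irreducible_def unit)
  ultimately show ?thesis
    using sub unfolding factorial_subring_def dvd by (auto simp: prime_elem_dvd_mult_iff)
qed

section \<open>Polynomials over a factorial subring\<close>

definition polys_over :: "'a::idom set \<Rightarrow> 'a poly set" where
  "polys_over R = {p. \<forall>i. coeff p i \<in> R}"

lemma subring_polys_over: "subring R \<Longrightarrow> subring (polys_over R)"
  unfolding subring_def[of "polys_over R"]
  by (auto simp: polys_over_def subringD coeff_mult intro!: subring_sum)

lemma smult_in_polys_over: "subring R \<Longrightarrow> a \<in> R \<Longrightarrow> p \<in> polys_over R \<Longrightarrow> smult a p \<in> polys_over R"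
  by (auto simp: polys_over_def subringD)

lemma monom_in_polys_over: "subring R \<Longrightarrow> a \<in> R \<Longrightarrow> monom a k \<in> polys_over R"
  by (auto simp: polys_over_def subringD coeff_monom)

lemma const_in_polys_over: "subring R \<Longrightarrow> [:a:] \<in> polys_over R \<longleftrightarrow> a \<in> R"
  by (auto simp: polys_over_def subringD coeff_pCons split: nat.split)

text \<open>Degrees add up, so an invertible polynomial and its inverse are both constant.\<close>
lemma unit_in_polys_over:
  assumes R: "subring R"
  shows "unit_in (polys_over R) P \<longleftrightarrow> (\<exists>u. unit_in R u \<and> P = [:u:])"
proof
  assume "unit_in (polys_over R) P"
  then obtain Q where PQ: "P \<in> polys_over R" "Q \<in> polys_over R" "P * Q = 1"
    by (auto simp: unit_in_def)
  then have "P \<noteq> 0" "Q \<noteq> 0" by auto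
  then have "degree P + degree Q = 0" using degree_mult_eq[of P Q] PQ(3) by simp
  then obtain u v where uv: "P = [:u:]" "Q = [:v:]"
    by (metis add_is_0 degree_eq_zeroE)
  then have "u * v = 1" using PQ(3) by (simp add: one_pCons mult.commute)
  then show "\<exists>u. unit_in R u \<and> P = [:u:]"
    using PQ uv R by (auto simp: unit_in_def const_in_polys_over)
next
  assume "\<exists>u. unit_in R u \<and> P = [:u:]"
  then obtain u v where "P = [:u:]" "u \<in> R" "v \<in> R" "u * v = 1" by (auto simp: unit_in_def)
  then show "unit_in (polys_over R) P"
    using R by (auto simp: unit_in_def const_in_polys_over one_pCons intro!: bexI[of _ "[:v:]"])
qed

text \<open>
  The quotients of the coefficients form a polynomial, as they vanish where the coefficients
  do; only for \<open>a = 0\<close> are they not determined.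
\<close>
lemma const_dvd_in_polys_over:
  assumes R: "subring R"
  shows "dvd_in (polys_over R) [:a:] F \<longleftrightarrow> (\<forall>i. dvd_in R a (coeff F i))"
proof
  assume "dvd_in (polys_over R) [:a:] F"
  then show "\<forall>i. dvd_in R a (coeff F i)" by (auto simp: dvd_in_def polys_over_def)
next
  assume *: "\<forall>i. dvd_in R a (coeff F i)"
  show "dvd_in (polys_over R) [:a:] F"
  proof (cases "a = 0")
    case True
    then have "F = 0" using * by (auto simp: dvd_in_def intro: poly_eqI)
    then show ?thesis using subringD(1)[OF subring_polys_over[OF R]]
      by (auto simp: dvd_in_def)
  next
    case False
    from * obtain g where g: "\<And>i. g i \<in> R" "\<And>i. coeff F i = a * g i"
      unfolding dvd_in_def by metis
    have "coeff (Abs_poly g) = g"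
    proof (rule coeff_Abs_poly)
      fix i assume "degree F < i"
      then have "a * g i = 0" using g(2)[of i] by (simp add: coeff_eq_0)
      then show "g i = 0" using False by simp
    qed
    then have "Abs_poly g \<in> polys_over R" "F = [:a:] * Abs_poly g"
      using g by (auto simp: polys_over_def intro: poly_eqI)
    then show ?thesis unfolding dvd_in_def by blast
  qed
qed

text \<open>
  Gauss's lemma: if \<open>i\<close> and \<open>j\<close> are the first indices at which \<open>p\<close> fails to divide the
  coefficients of \<open>F\<close> and \<open>G\<close>, then in coefficient \<open>i + j\<close> of \<open>F G\<close> all summands but one are
  divisible by \<open>p\<close>.
\<close>
lemma gauss_const_prime:
  assumes R: "factorial_subring R" and p: "irreducible_in R p"
    and FG: "F \<in> polys_over R" "G \<in> polys_over R"
    and dvd: "dvd_in (polys_over R) [:p:] (F * G)"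
  shows "dvd_in (polys_over R) [:p:] F \<or> dvd_in (polys_over R) [:p:] G"
proof (rule ccontr)
  note sub = factorial_subringD(1)[OF R]
  assume "\<not> ?thesis"
  then have ex: "\<exists>i. \<not> dvd_in R p (coeff F i)" "\<exists>j. \<not> dvd_in R p (coeff G j)"
    by (auto simp: const_dvd_in_polys_over[OF sub])
  define i where "i = (LEAST i. \<not> dvd_in R p (coeff F i))"
  define j where "j = (LEAST j. \<not> dvd_in R p (coeff G j))"
  have i: "\<not> dvd_in R p (coeff F i)" and j: "\<not> dvd_in R p (coeff G j)"
    unfolding i_def j_def using LeastI_ex[OF ex(1)] LeastI_ex[OF ex(2)] by blast+
  have lt: "k < i \<Longrightarrow> dvd_in R p (coeff F k)" "k < j \<Longrightarrow> dvd_in R p (coeff G k)" for k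
    unfolding i_def j_def using not_less_Least by blast+
  have inR: "coeff F k \<in> R" "coeff G k \<in> R" for k using FG by (auto simp: polys_over_def)
  let ?f = "\<lambda>k. coeff F k * coeff G (i + j - k)"
  have "coeff (F * G) (i + j) = ?f i + (\<Sum>k\<in>{..i+j} - {i}. ?f k)"
    unfolding coeff_mult by (rule sum.remove) auto
  moreover have "dvd_in R p (\<Sum>k\<in>{..i+j} - {i}. ?f k)"
  proof (rule dvd_in_sum[OF sub])
    fix k assume "k \<in> {..i+j} - {i}"
    then consider "k < i" | "i + j - k < j" by fastforce
    then show "dvd_in R p (?f k)"
    proof cases
      case 1
      then show ?thesis using dvd_in_mult[OF sub] lt inR by blast
    next
      case 2
      then show ?thesis using dvd_in_mult[OF sub lt(2) inR(1)] by (metis mult.commute)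
    qed
  qed
  moreover have "dvd_in R p (coeff (F * G) (i + j))"
    using dvd by (simp add: const_dvd_in_polys_over[OF sub])
  ultimately have "dvd_in R p (?f i)" using dvd_in_diff[OF sub] by fastforce
  then show False using factorial_subringD(3)[OF R p inR(1) inR(2), of i j] i j by simp
qed

text \<open>
  This replaces the passage to primitive polynomials over the field of fractions: each prime
  factor of \<open>c\<close> divides \<open>Q\<close> or \<open>D\<close> and is cancelled there; \<open>a\<close> and \<open>b\<close> collect the primes
  removed from either.
\<close>
lemma gauss_cancel_const:
  assumes R: "factorial_subring R" and c: "c \<in> R" "c \<noteq> 0"
    and P: "P \<in> polys_over R" "Q \<in> polys_over R" "D \<in> polys_over R"
    and eq: "smult c P = Q * D"
  shows "\<exists>a b Q1 D1. a \<in> R \<and> b \<in> R \<and> Q1 \<in> polys_over R \<and> D1 \<in> polys_over R \<and>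
           P = Q1 * D1 \<and> Q = smult a Q1 \<and> D = smult b D1"
proof -
  note sub = factorial_subringD(1)[OF R]
  obtain u A where u: "unit_in R u" and A: "\<forall>p\<in>#A. irreducible_in R p"
    and c_eq: "c = u * prod_mset A"
    using irreducible_factorization_exists[OF R c] by blast
  have "smult (u * prod_mset A) P = Q * D" using eq c_eq by simp
  then show ?thesis using A P(2,3)
  proof (induction A arbitrary: Q D)
    case empty
    obtain v where v: "v \<in> R" "u * v = 1" and uR: "u \<in> R" using u by (auto simp: unit_in_def)
    have "smult v Q * D = smult v (smult u P)" using empty by simp
    also have "\<dots> = P" using v by (simp add: mult.commute)
    finally have 1: "P = smult v Q * D" by simp
    have 2: "Q = smult u (smult v Q)" using v by simp
    show ?case
      using 1 2 v uR empty sub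
      by (intro exI[of _ u] exI[of _ 1] exI[of _ "smult v Q"] exI[of _ D])
         (auto simp: smult_in_polys_over subringD)
  next
    case (add p A)
    have p: "irreducible_in R p" using add.prems by simp
    then have pR: "p \<in> R" "p \<noteq> 0"
      using irreducible_in_nonzero[OF sub] by (auto simp: irreducible_in_def)
    let ?c = "u * prod_mset A"
    have "?c \<in> R" using u add.prems sub
      by (auto simp: unit_in_def irreducible_in_def intro!: subringD subring_prod_mset)
    then have cP: "smult ?c P \<in> polys_over R" using P sub by (intro smult_in_polys_over)
    have eq': "smult p (smult ?c P) = Q * D" using add.prems(1) by (simp add: mult_ac)
    then have "dvd_in (polys_over R) [:p:] (Q * D)"
      using cP by (simp only: dvd_in_def eq'[symmetric]) (auto intro!: bexI[of _ "smult ?c P"])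
    then consider "dvd_in (polys_over R) [:p:] Q" | "dvd_in (polys_over R) [:p:] D"
      using gauss_const_prime[OF R p] add.prems by blast
    then show ?case
    proof cases
      case 1
      then obtain Q' where Q': "Q' \<in> polys_over R" "Q = smult p Q'" by (auto simp: dvd_in_def)
      then have "smult p (smult ?c P) = smult p (Q' * D)" using eq' by simp
      then have "smult ?c P = Q' * D" using pR smult_cancel[of p] by blast
      then obtain a b Q1 D1 where "a \<in> R" "b \<in> R" "Q1 \<in> polys_over R" "D1 \<in> polys_over R"
        "P = Q1 * D1" "Q' = smult a Q1" "D = smult b D1"
        using add.IH[of Q' D] add.prems Q' by auto
      then show ?thesis using Q' pR sub
        by (intro exI[of _ "p * a"] exI[of _ b] exI[of _ Q1] exI[of _ D1]) (auto simp: subringD)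
    next
      case 2
      then obtain D' where D': "D' \<in> polys_over R" "D = smult p D'" by (auto simp: dvd_in_def)
      then have "smult p (smult ?c P) = smult p (Q * D')" using eq' by simp
      then have "smult ?c P = Q * D'" using pR smult_cancel[of p] by blast
      then obtain a b Q1 D1 where "a \<in> R" "b \<in> R" "Q1 \<in> polys_over R" "D1 \<in> polys_over R"
        "P = Q1 * D1" "Q = smult a Q1" "D' = smult b D1"
        using add.IH[of Q D'] add.prems D' by auto
      then show ?thesis using D' pR sub
        by (intro exI[of _ a] exI[of _ "p * b"] exI[of _ Q1] exI[of _ D1]) (auto simp: subringD)
    qed
  qed
qed

text \<open>
  By \<open>gauss_cancel_const\<close>, \<open>P\<close> is a constant times a divisor of \<open>G\<close>; a non-constant irreducible
  polynomial has only unit constant factors.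
\<close>
lemma irreducible_dvd_smult:
  assumes R: "factorial_subring R" and P: "irreducible_in (polys_over R) P" "degree P > 0"
    and c: "c \<in> R" "c \<noteq> 0" and G: "G \<in> polys_over R"
    and dvd: "dvd_in (polys_over R) P (smult c G)"
  shows "dvd_in (polys_over R) P G"
proof -
  note sub = factorial_subringD(1)[OF R]
  from dvd obtain W where W: "W \<in> polys_over R" "smult c G = P * W" by (auto simp: dvd_in_def)
  have PR: "P \<in> polys_over R" using P by (simp add: irreducible_in_def)
  obtain a b Q1 D1 where *: "a \<in> R" "b \<in> R" "Q1 \<in> polys_over R" "D1 \<in> polys_over R"
    "G = Q1 * D1" "P = smult a Q1"
    using gauss_cancel_const[OF R c G PR W] by blast
  have "P = [:a:] * Q1" using * by simp
  moreover have "\<not> unit_in (polys_over R) Q1"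
    using P(2) * by (auto simp: unit_in_polys_over[OF sub] split: if_splits)
  ultimately have "unit_in (polys_over R) [:a:]"
    using P(1) * sub unfolding irreducible_in_def by (metis const_in_polys_over)
  then have "unit_in R a" by (simp add: unit_in_polys_over[OF sub])
  then obtain v where v: "v \<in> R" "a * v = 1" by (auto simp: unit_in_def)
  have "P * smult v D1 = G" using * v by (simp add: mult.commute[of v])
  then show ?thesis using v * sub unfolding dvd_in_def by (metis smult_in_polys_over)
qed

text \<open>
  An ideal of \<open>R[x]\<close> becomes principal once constants may be inverted.  One step of
  pseudo-division, \<open>lc D H - lc H x\<^sup>k D\<close>, stays in the ideal and lowers the degree, and it can be
  repeated until nothing is left because no nonzero element has degree below that of \<open>D\<close>.
\<close>
lemma ideal_pseudo_generator:
  assumes R: "subring R" and A: "A \<subseteq> polys_over R"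
    and cl: "\<And>H K U V. H \<in> A \<Longrightarrow> K \<in> A \<Longrightarrow> U \<in> polys_over R \<Longrightarrow> V \<in> polys_over R \<Longrightarrow> U * H - V * K \<in> A"
    and D: "D \<in> A" "D \<noteq> 0" and min: "\<And>H. H \<in> A \<Longrightarrow> H \<noteq> 0 \<Longrightarrow> degree D \<le> degree H"
    and H: "H \<in> A"
  shows "\<exists>c\<in>R - {0}. \<exists>Q\<in>polys_over R. smult c H = Q * D"
  using H
proof (induction "degree H" arbitrary: H rule: less_induct)
  note subP = subring_polys_over[OF R]
  case less
  show ?case
  proof (cases "H = 0")
    case True
    then show ?thesis using subringD[OF R] subringD[OF subP]
      by (intro bexI[of _ 1] bexI[of _ 0]) auto
  next
    case False
    let ?d = "lead_coeff D" and ?M = "monom (lead_coeff H) (degree H - degree D)"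
    let ?H = "smult ?d H - ?M * D"
    have inR: "coeff D i \<in> R" "coeff H i \<in> R" for i
      using A D less.prems by (auto simp: polys_over_def)
    have M: "?M \<in> polys_over R" using inR R by (intro monom_in_polys_over) auto
    have "[:?d:] * H - ?M * D \<in> A"
      using less.prems D inR R M by (intro cl) (auto simp: const_in_polys_over)
    then have HA: "?H \<in> A" by simp
    have le: "degree D \<le> degree H" using min less.prems False by blast
    have nz: "lead_coeff D \<noteq> 0" "lead_coeff H \<noteq> 0" using D False by auto
    obtain c' Q' where c': "c' \<in> R" "c' \<noteq> 0" "Q' \<in> polys_over R" "smult c' ?H = Q' * D"
    proof (cases "?H = 0")
      case True
      then show ?thesis using that[of 1 0] subringD[OF R] subringD[OF subP] by auto
    next
      case ne: False
      have deg: "degree (?M * D) = degree H"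
        using nz le D by (subst degree_mult_eq) (auto simp: degree_monom_eq)
      have "lead_coeff (?M * D) = lead_coeff H * ?d"
        by (simp only: lead_coeff_mult lead_coeff_monom)
      then have "coeff ?H (degree H) = 0" using deg by simp
      moreover have "degree ?H \<le> degree H"
        using deg by (intro degree_diff_le) auto
      ultimately have "degree ?H < degree H"
        using ne by (metis eq_zero_or_degree_less)
      then show ?thesis using less.hyps[OF _ HA] that by blast
    qed
    have "smult (c' * ?d) H = (Q' + smult c' ?M) * D"
      using c'(4) by (simp add: smult_diff_right distrib_right algebra_simps)
    moreover have "c' * ?d \<in> R - {0}" using c' nz inR R by (auto simp: subringD)
    moreover have "Q' + smult c' ?M \<in> polys_over R"
      using c' M R subP by (intro subringD(4) smult_in_polys_over)
    ultimately show ?thesis by blast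
  qed
qed

text \<open>
  The argument that makes irreducibles prime in a principal ideal domain, applied to the ideal
  generated by \<open>P\<close> and \<open>F\<close>, with the extra constants removed by \<open>gauss_cancel_const\<close> and
  \<open>irreducible_dvd_smult\<close>.
\<close>
lemma gauss_irreducible_prime:
  assumes R: "factorial_subring R" and P: "irreducible_in (polys_over R) P" "degree P > 0"
    and F: "F \<in> polys_over R" and G: "G \<in> polys_over R"
    and dvd: "dvd_in (polys_over R) P (F * G)"
  shows "dvd_in (polys_over R) P F \<or> dvd_in (polys_over R) P G"
proof -
  note sub = factorial_subringD(1)[OF R]
  let ?S = "polys_over R"
  note subS = subring_polys_over[OF sub]
  note clS = subringD[OF subS]
  have PS: "P \<in> ?S" using P by (simp add: irreducible_in_def)
  define A where "A = {U * P + V * F | U V. U \<in> ?S \<and> V \<in> ?S}"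
  have A_I: "U \<in> ?S \<Longrightarrow> V \<in> ?S \<Longrightarrow> U * P + V * F \<in> A" for U V by (auto simp: A_def)
  have PA: "P \<in> A" using A_I[of 1 0] clS by simp
  have FA: "F \<in> A" using A_I[of 0 1] clS by simp
  have AS: "A \<subseteq> ?S" using PS F clS by (auto simp: A_def)
  have cl: "U * H - V * K \<in> A" if "H \<in> A" "K \<in> A" "U \<in> ?S" "V \<in> ?S" for H K U V
  proof -
    from that(1,2) obtain U1 V1 U2 V2 where *: "H = U1 * P + V1 * F" "K = U2 * P + V2 * F"
      "U1 \<in> ?S" "V1 \<in> ?S" "U2 \<in> ?S" "V2 \<in> ?S" by (auto simp: A_def)
    have "U * H - V * K = (U * U1 - V * U2) * P + (U * V1 - V * V2) * F"
      by (simp add: * algebra_simps)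
    also have "\<dots> \<in> A" using * that clS by (intro A_I) auto
    finally show ?thesis .
  qed
  have P0: "P \<noteq> 0" using P by auto
  obtain D where D: "D \<in> A" "D \<noteq> 0" and min: "\<And>H. H \<in> A \<Longrightarrow> H \<noteq> 0 \<Longrightarrow> degree D \<le> degree H"
    using ex_has_least_nat[of "\<lambda>H. H \<in> A \<and> H \<noteq> 0" P degree] PA P0 by blast
  have gen: "\<exists>c\<in>R - {0}. \<exists>Q\<in>?S. smult c H = Q * D" if "H \<in> A" for H
    by (rule ideal_pseudo_generator[OF sub AS _ D _ that]) (fact cl, fact min)
  obtain c Q where c: "c \<in> R" "c \<noteq> 0" and Q: "Q \<in> ?S" "smult c P = Q * D"
    using gen[OF PA] by blast
  obtain e W where e: "e \<in> R" "e \<noteq> 0" and W: "W \<in> ?S" "smult e F = W * D"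
    using gen[OF FA] by blast
  obtain a b Q1 D1 where *: "a \<in> R" "b \<in> R" "Q1 \<in> ?S" "D1 \<in> ?S"
    "P = Q1 * D1" "Q = smult a Q1" "D = smult b D1"
    using gauss_cancel_const[OF R c PS Q(1) _ Q(2)] D AS by blast
  then have "unit_in ?S Q1 \<or> unit_in ?S D1" using P(1) by (auto simp: irreducible_in_def)
  then show ?thesis
  proof
    \<comment> \<open>\<open>D\<close> is a constant multiple of \<open>P\<close>, and it divides \<open>e F\<close>\<close>
    assume "unit_in ?S Q1"
    then obtain v where v: "v \<in> ?S" "Q1 * v = 1" by (auto simp: unit_in_def)
    then have "D1 = P * v" using * by (metis mult.commute mult.assoc mult_1_right)
    then have "smult e F = P * (smult b v * W)" using W(2) *(7) by (simp add: mult_ac)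
    moreover have "smult b v * W \<in> ?S"
      using v(1) W(1) *(2) by (intro clS(5) smult_in_polys_over[OF sub])
    ultimately have "dvd_in ?S P (smult e F)"
      unfolding dvd_in_def by blast
    then show ?thesis using irreducible_dvd_smult[OF R P e F] by blast
  next
    \<comment> \<open>\<open>D\<close> is a constant; multiplying \<open>D = U P + V F\<close> by \<open>G\<close> gives \<open>P\<close> dividing \<open>D G\<close>\<close>
    assume "unit_in ?S D1"
    then obtain d where "unit_in R d" "D1 = [:d:]" by (auto simp: unit_in_polys_over[OF sub])
    then have Dc: "D = [:b * d:]" and bd: "b * d \<in> R" "b * d \<noteq> 0"
      using * D sub by (auto simp: unit_in_def subringD)
    obtain U V where UV: "D = U * P + V * F" "U \<in> ?S" "V \<in> ?S" using D by (auto simp: A_def)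
    have "smult (b * d) G = P * (U * G) + (F * G) * V"
      using arg_cong[OF UV(1), of "\<lambda>x. x * G"] by (simp add: Dc algebra_simps)
    moreover have "dvd_in ?S P (P * (U * G))" using UV G clS by (auto simp: dvd_in_def)
    ultimately have "dvd_in ?S P (smult (b * d) G)"
      using dvd_in_add[OF subS] dvd_in_mult[OF subS dvd UV(3)] by simp
    then show ?thesis using irreducible_dvd_smult[OF R P bd G] by blast
  qed
qed

lemma length_on_polys_over:
  assumes R: "subring R" and N: "length_on R N"
  shows "length_on (polys_over R) (\<lambda>P. degree P + N (lead_coeff P))"
proof -
  have lc: "lead_coeff P \<in> R - {0}" if "P \<in> polys_over R" "P \<noteq> 0" for P
    using that by (auto simp: polys_over_def)
  have "degree P + N (lead_coeff P) = 0 \<longleftrightarrow> unit_in (polys_over R) P"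
    if "P \<in> polys_over R" "P \<noteq> 0" for P
  proof
    assume "degree P + N (lead_coeff P) = 0"
    then show "unit_in (polys_over R) P"
      using lc[OF that] N unfolding unit_in_polys_over[OF R] length_on_def
      by (metis add_is_0 degree_0_id)
  next
    assume "unit_in (polys_over R) P"
    then show "degree P + N (lead_coeff P) = 0"
      using lc[OF that] N unfolding unit_in_polys_over[OF R] length_on_def by auto
  qed
  moreover have "N (lead_coeff (P * Q)) = N (lead_coeff P) + N (lead_coeff Q)"
    if "P \<in> polys_over R" "P \<noteq> 0" "Q \<in> polys_over R" "Q \<noteq> 0" for P Q
    using N lc[OF that(1,2)] lc[OF that(3,4)] unfolding length_on_def lead_coeff_mult by blast
  moreover have "degree (P * Q) = degree P + degree Q" if "P \<noteq> 0" "Q \<noteq> 0" for P Q :: "'a poly"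
    using that by (rule degree_mult_eq)
  ultimately show ?thesis unfolding length_on_def[of "polys_over R"]
    by (intro conjI ballI) (simp_all del: add_is_0)
qed

theorem factorial_polys_over:
  assumes R: "factorial_subring R"
  shows "factorial_subring (polys_over R)"
proof -
  note sub = factorial_subringD(1)[OF R]
  have "dvd_in (polys_over R) P F \<or> dvd_in (polys_over R) P G"
    if P: "irreducible_in (polys_over R) P" and FG: "F \<in> polys_over R" "G \<in> polys_over R"
      and dvd: "dvd_in (polys_over R) P (F * G)" for P F G
  proof (cases "degree P = 0")
    case True
    then obtain p where p: "P = [:p:]" by (metis degree_eq_zeroE)
    have "irreducible_in R p"
      unfolding irreducible_in_def
    proof (intro conjI ballI impI)
      have const: "unit_in (polys_over R) [:u:] \<longleftrightarrow> unit_in R u" for u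
        by (simp add: unit_in_polys_over[OF sub])
      show "p \<in> R" "\<not> unit_in R p"
        using P by (simp_all add: p irreducible_in_def const const_in_polys_over[OF sub])
      fix u v assume uv: "u \<in> R" "v \<in> R" "p = u * v"
      then have "[:u:] \<in> polys_over R" "[:v:] \<in> polys_over R" "P = [:u:] * [:v:]"
        by (simp_all add: p const_in_polys_over[OF sub])
      then have "unit_in (polys_over R) [:u:] \<or> unit_in (polys_over R) [:v:]"
        using P unfolding irreducible_in_def by blast
      then show "unit_in R u \<or> unit_in R v" by (simp only: const)
    qed
    then show ?thesis using gauss_const_prime[OF R _ FG] dvd p by blast
  next
    case False
    then show ?thesis using gauss_irreducible_prime[OF R P _ FG dvd] by simp
  qed
  then show ?thesis
    unfolding factorial_subring_def
    using subring_polys_over[OF sub] length_on_polys_over[OF sub] factorial_subringD(2)[OF R]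
    by blast
qed

section \<open>The rings of integer polynomials\<close>

abbreviation eval_last :: "nat \<Rightarrow> ipoly poly \<Rightarrow> ipoly" where
  "eval_last n p \<equiv> poly p (X (Suc n))"

lemma subring_PI: "subring (PI n)"
  by (auto simp: subring_def zero_in_PI one_in_PI uminus_in_PI add_in_PI mult_in_PI)

lemma X_nonzero: "X i \<noteq> 0"
  by (auto simp: X_def simp flip: lookup_inject dest!: fun_cong[of _ _ "Poly_Mapping.single i 1"])

text \<open>
  \<open>X (Suc n)\<close> is transcendental over \<^term>\<open>PI n\<close>: the constant term of \<open>p\<close> involves no monomial
  with \<open>X (Suc n)\<close>, whereas the rest of the value is a multiple of \<open>X (Suc n)\<close>; hence both vanish.
\<close>
lemma eval_last_eq_0:
  assumes "p \<in> polys_over (PI n)" "eval_last n p = 0"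
  shows "p = 0"
  using assms
proof (induction p)
  case (pCons a p)
  have a: "a \<in> PI n" and p: "p \<in> polys_over (PI n)"
    using pCons.prems(1) unfolding polys_over_def
    by (auto dest: spec[of _ 0], metis coeff_pCons_Suc)
  have eq: "a = - (X (Suc n) * eval_last n p)"
    using pCons.prems(2) by (simp add: eq_neg_iff_add_eq_0)
  have "m \<notin> Poly_Mapping.keys a" for m
  proof
    assume m: "m \<in> Poly_Mapping.keys a"
    then have "m \<in> Poly_Mapping.keys (X (Suc n) * eval_last n p)" by (subst (asm) eq) simp
    then obtain m' where "m = Poly_Mapping.single (Suc n) 1 + m'"
      using keys_mult[of "X (Suc n)" "eval_last n p"] by (auto simp: X_def)
    then have "Suc n \<in> Poly_Mapping.keys m" by (simp add: in_keys_iff lookup_add)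
    moreover have "Poly_Mapping.keys m \<subseteq> {1..n}" using a m by (auto simp: PI_def)
    ultimately show False by auto
  qed
  then have "a = 0" by (metis all_not_in_conv keys_eq_empty)
  then show ?case using pCons.IH[OF p] eq X_nonzero by simp
qed simp

lemma inj_on_eval_last: "inj_on (eval_last n) (polys_over (PI n))"
proof (rule inj_onI)
  fix p q assume "p \<in> polys_over (PI n)" "q \<in> polys_over (PI n)" "eval_last n p = eval_last n q"
  then have "p - q = 0"
    by (intro eval_last_eq_0 subringD[OF subring_polys_over[OF subring_PI]]) auto
  then show "p = q" by simp
qed

text \<open>
  Sums in descending powers, as in the recursive definition of positivity, turned into
  univariate polynomials; the first coefficient may be zero, hence only a degree bound.
\<close>
lemma sum_as_eval_last:
  assumes "\<forall>i\<le>d. c i \<in> PI n"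
  obtains q where "q \<in> polys_over (PI n)" "eval_last n q = (\<Sum>i\<le>d. c i * X (Suc n) ^ (d - i))"
    "coeff q d = c 0" "degree q \<le> d"
proof
  let ?q = "\<Sum>i\<le>d. monom (c i) (d - i)"
  show "?q \<in> polys_over (PI n)"
    using assms by (intro subring_sum subring_polys_over monom_in_polys_over subring_PI) auto
  show "eval_last n ?q = (\<Sum>i\<le>d. c i * X (Suc n) ^ (d - i))"
    by (simp add: poly_sum poly_monom)
  have "coeff ?q d = (\<Sum>i\<le>d. if i = 0 then c 0 else 0)"
    unfolding coeff_sum coeff_monom by (intro sum.cong) auto
  then show "coeff ?q d = c 0" by simp
  show "degree ?q \<le> d"
    by (intro degree_sum_le) (auto intro: order_trans[OF degree_monom_le])
qed

lemma eval_last_as_sum: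
  "eval_last n p = (\<Sum>i\<le>degree p. coeff p (degree p - i) * X (Suc n) ^ (degree p - i))"
  unfolding poly_altdef
  by (rule sum.reindex_bij_witness[of _ "\<lambda>i. degree p - i" "\<lambda>i. degree p - i"]) auto

lemma PI_Suc_image: "PI (Suc n) = eval_last n ` polys_over (PI n)"
proof (intro equalityI subsetI)
  fix P assume "P \<in> PI (Suc n)"
  then obtain d c where "P = (\<Sum>i\<le>d. c i * X (Suc n) ^ (d - i))" "\<forall>i\<le>d. c i \<in> PI n"
    unfolding PI_Suc by blast
  moreover from this(2) obtain q where "q \<in> polys_over (PI n)"
    "eval_last n q = (\<Sum>i\<le>d. c i * X (Suc n) ^ (d - i))" by (rule sum_as_eval_last)
  ultimately show "P \<in> eval_last n ` polys_over (PI n)" by (intro image_eqI) auto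
next
  fix P assume "P \<in> eval_last n ` polys_over (PI n)"
  then obtain p where p: "p \<in> polys_over (PI n)" "P = eval_last n p" by blast
  show "P \<in> PI (Suc n)"
    unfolding PI_Suc p(2) mem_Collect_eq using p(1)
    by (intro exI[of _ "degree p"] exI[of _ "\<lambda>i. coeff p (degree p - i)"])
       (simp add: eval_last_as_sum[symmetric] polys_over_def)
qed

lemma factorial_PI: "factorial_subring (PI n)"
proof (induction n)
  case 0
  show ?case unfolding PI_0
    by (rule factorial_subring_image[OF factorial_subring_int]) (auto simp: inj_def)
next
  case (Suc n)
  show ?case unfolding PI_Suc_image
    by (rule factorial_subring_image[OF factorial_polys_over[OF Suc] inj_on_eval_last]) auto
qed

lemma unit_PI_cases: "unit_in (PI n) u \<Longrightarrow> u = 1 \<or> u = - 1"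
proof (induction n arbitrary: u)
  case 0
  then obtain a :: int where a: "u = of_int a" unfolding PI_0 unit_in_def by blast
  have "unit_in (range (of_int :: int \<Rightarrow> ipoly)) (of_int a) \<longleftrightarrow> unit_in (UNIV :: int set) a"
    by (rule unit_in_image[OF factorial_subring_int]) (auto simp: inj_def)
  then have "unit_in (UNIV :: int set) a"
    using 0 unfolding PI_0 a by blast
  then have "a = 1 \<or> a = - 1" by (auto simp: unit_in_def zmult_eq_1_iff)
  then show ?case using a by auto
next
  case (Suc n)
  then obtain p where p: "p \<in> polys_over (PI n)" "u = eval_last n p"
    unfolding PI_Suc_image unit_in_def by blast
  have "unit_in (eval_last n ` polys_over (PI n)) (eval_last n p) \<longleftrightarrow> unit_in (polys_over (PI n)) p"
    by (rule unit_in_image[OF factorial_polys_over[OF factorial_PI] inj_on_eval_last _ _ _ p(1)]) auto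
  then have "unit_in (polys_over (PI n)) p"
    using Suc.prems unfolding PI_Suc_image p(2) by blast
  then show ?case using Suc.IH p(2) unfolding unit_in_polys_over[OF subring_PI] by fastforce
qed

section \<open>Positivity\<close>

text \<open>
  The definition of positivity asks for some expansion with positive first coefficient; since
  expansions are unique, that coefficient is the leading one.
\<close>
lemma positive_eval_last:
  assumes p: "p \<in> polys_over (PI n)"
  shows "positive (Suc n) (eval_last n p) \<longleftrightarrow> p \<noteq> 0 \<and> positive n (lead_coeff p)"
proof
  assume "positive (Suc n) (eval_last n p)"
  then obtain d c where *: "\<forall>i\<le>d. c i \<in> PI n" "eval_last n p = (\<Sum>i\<le>d. c i * X (Suc n) ^ (d - i))"
    "c 0 \<noteq> 0" "positive n (c 0)" unfolding positive.simps by blast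
  obtain q where q: "q \<in> polys_over (PI n)" "eval_last n q = eval_last n p"
    "coeff q d = c 0" "degree q \<le> d"
    unfolding *(2) by (rule sum_as_eval_last[OF *(1)])
  have "q = p" using inj_onD[OF inj_on_eval_last q(2,1) p] .
  moreover have "degree q = d" using q * by (metis le_antisym le_degree)
  ultimately show "p \<noteq> 0 \<and> positive n (lead_coeff p)" using q * by auto
next
  assume "p \<noteq> 0 \<and> positive n (lead_coeff p)"
  then show "positive (Suc n) (eval_last n p)"
    unfolding positive.simps using p eval_last_as_sum[of p n]
    by (intro exI[of _ "degree p"] exI[of _ "\<lambda>i. coeff p (degree p - i)"])
       (auto simp: polys_over_def)
qed

lemma positive_imp_in_PI: "positive n P \<Longrightarrow> P \<in> PI n"
  by (cases n) (auto simp: PI_0 PI_Suc)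

lemma positive_ex_eval_last:
  assumes "positive (Suc n) P"
  obtains p where "p \<in> polys_over (PI n)" "P = eval_last n p" "p \<noteq> 0" "positive n (lead_coeff p)"
  using assms positive_imp_in_PI[OF assms] positive_eval_last unfolding PI_Suc_image by blast

lemma positive_dichotomy: "P \<in> PI n \<Longrightarrow> P \<noteq> 0 \<Longrightarrow> positive n (- P) \<longleftrightarrow> \<not> positive n P"
proof (induction n arbitrary: P)
  case 0
  then obtain a where a: "P = of_int a" "a \<noteq> 0" by (auto simp: PI_0)
  have "positive 0 (of_int b) \<longleftrightarrow> b > 0" for b by auto
  from this[of a] this[of "- a"] show ?case using a by auto
next
  case (Suc n)
  then obtain p where p: "p \<in> polys_over (PI n)" "P = eval_last n p" "p \<noteq> 0"
    unfolding PI_Suc_image by force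
  have "- p \<in> polys_over (PI n)"
    using p by (intro subringD subring_polys_over subring_PI)
  then have "positive (Suc n) (- P) \<longleftrightarrow> positive n (- lead_coeff p)"
    using positive_eval_last[of "- p" n] p by simp
  moreover have "positive (Suc n) P \<longleftrightarrow> positive n (lead_coeff p)"
    using positive_eval_last p by simp
  moreover have "lead_coeff p \<in> PI n" "lead_coeff p \<noteq> 0" using p by (auto simp: polys_over_def)
  ultimately show ?case using Suc.IH by simp
qed

lemma positive_one: "positive n 1"
proof (induction n)
  case 0
  show ?case by (auto intro: exI[of _ 1])
next
  case (Suc n)
  then show ?case using positive_eval_last[of 1 n] subring_polys_over[OF subring_PI]
    by (auto simp: subringD)
qed

lemma positive_mult: "positive n P \<Longrightarrow> positive n Q \<Longrightarrow> positive n (P * Q)"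
proof (induction n arbitrary: P Q)
  case 0
  then show ?case by (auto, metis mult_pos_pos of_int_mult)
next
  case (Suc n)
  obtain p q where p: "p \<in> polys_over (PI n)" "P = eval_last n p" "p \<noteq> 0" "positive n (lead_coeff p)"
    and q: "q \<in> polys_over (PI n)" "Q = eval_last n q" "q \<noteq> 0" "positive n (lead_coeff q)"
    using Suc.prems by (metis positive_ex_eval_last)
  have "p * q \<in> polys_over (PI n)" using p q subring_polys_over[OF subring_PI] by (auto simp: subringD)
  then show ?case
    using positive_eval_last[of "p * q" n] Suc.IH p q by (simp add: lead_coeff_mult)
qed

lemma positive_prod_mset: "(\<And>p. p \<in># A \<Longrightarrow> positive n p) \<Longrightarrow> positive n (prod_mset A)"
  by (induction A) (auto simp: positive_one positive_mult)

section \<open>Factorization into prime polynomials\<close>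

lemma prime_polys_iff: "p \<in> prime_polys n \<longleftrightarrow> positive n p \<and> irreducible_in (PI n) p"
  by (simp add: prime_polys_def irreducible_in_PI_def irreducible_in_def unit_in_PI_def unit_in_def)

lemma irreducible_uminus:
  assumes "subring R" "irreducible_in R p" shows "irreducible_in R (- p)"
proof -
  have unit: "unit_in R (- u) \<Longrightarrow> unit_in R u" for u
    using assms(1) unfolding unit_in_def by (metis minus_minus minus_mult_commute subringD(3))
  show ?thesis
    using assms unit unfolding irreducible_in_def
    by (metis minus_minus mult_minus_left subringD(3))
qed

lemma prime_polys_factorization_exists:
  assumes M: "M \<in> PI n" "M \<noteq> 0"
  shows "\<exists>A. set_mset A \<subseteq> prime_polys n \<and> (M = prod_mset A \<or> M = - prod_mset A)"
proof -
  obtain u A where u: "unit_in (PI n) u" and A: "\<forall>p\<in>#A. irreducible_in (PI n) p"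
    and M_eq: "M = u * prod_mset A"
    using irreducible_factorization_exists[OF factorial_PI M] by blast
  have "\<exists>B. set_mset B \<subseteq> prime_polys n \<and> (prod_mset A = prod_mset B \<or> prod_mset A = - prod_mset B)"
    using A
  proof (induction A)
    case empty
    show ?case by (intro exI[of _ "{#}"]) auto
  next
    case (add p A)
    then obtain B where B: "set_mset B \<subseteq> prime_polys n"
      "prod_mset A = prod_mset B \<or> prod_mset A = - prod_mset B" by auto
    have p: "irreducible_in (PI n) p" using add by simp
    then have "positive n p \<or> positive n (- p)"
      using positive_dichotomy irreducible_in_nonzero[OF subring_PI]
      unfolding irreducible_in_def by blast
    then have "p \<in> prime_polys n \<or> - p \<in> prime_polys n"
      using p irreducible_uminus[OF subring_PI p] by (auto simp: prime_polys_iff)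
    then obtain p' where "p' \<in> prime_polys n" "p = p' \<or> p = - p'" by (metis minus_minus)
    then show ?case using B by (intro exI[of _ "add_mset p' B"]) auto
  qed
  then show ?thesis using unit_PI_cases[OF u] M_eq by (metis minus_minus mult_1 mult_minus1)
qed

text \<open>Distinct associates differ by the factor \<open>-1\<close>, and then only one of them is positive.\<close>
lemma prime_polys_multiset_unique:
  assumes "set_mset A \<subseteq> prime_polys n" "set_mset B \<subseteq> prime_polys n" "prod_mset A = prod_mset B"
  shows "A = B"
proof (rule irreducible_multiset_unique[OF factorial_PI _ _ assms])
  fix p q u assume pq: "p \<in> prime_polys n" "q \<in> prime_polys n" "unit_in (PI n) u" "p = q * u"
  then have pos: "positive n p" "positive n q" and q: "q \<in> PI n" "q \<noteq> 0"
    using irreducible_in_nonzero[OF subring_PI]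
    by (auto simp: prime_polys_iff irreducible_in_def)
  show "p = q"
  proof (rule ccontr)
    assume "p \<noteq> q"
    then have "p = - q" using unit_PI_cases[OF pq(3)] pq(4) by auto
    then show False using positive_dichotomy[OF q] pos by simp
  qed
qed (simp add: prime_polys_iff)

lemma sign_pm_positive:
  assumes "positive n P" "P \<noteq> 0"
  shows "sign n P = 1" "sign n (- P) = - 1"
  using assms positive_dichotomy[OF positive_imp_in_PI] by (auto simp: sign_def negative_def)

text \<open>Multiplicity functions of finite support on \<open>S\<close> are multisets over \<open>S\<close>.\<close>
lemma prod_power_eq_prod_mset:
  assumes "\<forall>p. p \<notin> S \<longrightarrow> \<nu> p = 0" "finite {p \<in> S. \<nu> p \<noteq> (0::nat)}"
  shows "set_mset (Abs_multiset \<nu>) \<subseteq> S" "count (Abs_multiset \<nu>) = \<nu>"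
    "(\<Prod>p\<in>{p \<in> S. \<nu> p \<noteq> 0}. p ^ \<nu> p) = prod_mset (Abs_multiset \<nu>)"
proof -
  have S: "{p. \<nu> p > 0} = {p \<in> S. \<nu> p \<noteq> 0}" using assms(1) by auto
  then show c: "count (Abs_multiset \<nu>) = \<nu>" using assms(2) by (intro count_Abs_multiset) simp
  have s: "set_mset (Abs_multiset \<nu>) = {p \<in> S. \<nu> p \<noteq> 0}" by (simp add: set_mset_def c S)
  then show "set_mset (Abs_multiset \<nu>) \<subseteq> S" by auto
  show "(\<Prod>p\<in>{p \<in> S. \<nu> p \<noteq> 0}. p ^ \<nu> p) = prod_mset (Abs_multiset \<nu>)"
    by (simp add: prod_mset_multiplicity c s)
qed

theorem mainTheorem1:
  fixes n :: nat and M :: ipoly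
  assumes "M \<in> PI n" and "M \<noteq> 0"
  shows "\<exists>!\<nu> :: ipoly \<Rightarrow> nat.
    (\<forall>p. p \<notin> prime_polys n \<longrightarrow> \<nu> p = 0) \<and>
    finite {p \<in> prime_polys n. \<nu> p \<noteq> 0} \<and>
    M = of_int (sign n M) * (\<Prod>p\<in>{p \<in> prime_polys n. \<nu> p \<noteq> 0}. p ^ \<nu> p)"
proof -
  obtain A where A: "set_mset A \<subseteq> prime_polys n" "M = prod_mset A \<or> M = - prod_mset A"
    using prime_polys_factorization_exists[OF assms] by blast
  have "positive n (prod_mset A)" using A(1) by (intro positive_prod_mset) (auto simp: prime_polys_iff)
  moreover have "prod_mset A \<noteq> 0" using A(2) assms(2) by auto
  ultimately have M: "M = of_int (sign n M) * prod_mset A" using A(2) sign_pm_positive by auto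
  show ?thesis
  proof (rule ex1I[of _ "count A"], intro conjI)
    show out: "\<forall>p. p \<notin> prime_polys n \<longrightarrow> count A p = 0"
      using A(1) by (auto simp: count_eq_zero_iff)
    show fin: "finite {p \<in> prime_polys n. count A p \<noteq> 0}"
      by (rule finite_subset[of _ "set_mset A"]) (auto simp: count_eq_zero_iff)
    show "M = of_int (sign n M) * (\<Prod>p\<in>{p \<in> prime_polys n. count A p \<noteq> 0}. p ^ count A p)"
      using M prod_power_eq_prod_mset(3)[OF out fin] by (simp add: count_inverse)
  next
    fix \<nu> :: "ipoly \<Rightarrow> nat"
    assume *: "(\<forall>p. p \<notin> prime_polys n \<longrightarrow> \<nu> p = 0) \<and>
      finite {p \<in> prime_polys n. \<nu> p \<noteq> 0} \<and>
      M = of_int (sign n M) * (\<Prod>p\<in>{p \<in> prime_polys n. \<nu> p \<noteq> 0}. p ^ \<nu> p)"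
    then have 1: "\<forall>p. p \<notin> prime_polys n \<longrightarrow> \<nu> p = 0" "finite {p \<in> prime_polys n. \<nu> p \<noteq> 0}"
      by blast+
    have "of_int (sign n M) * prod_mset (Abs_multiset \<nu>) = of_int (sign n M) * prod_mset A"
      using * M prod_power_eq_prod_mset(3)[OF 1] by simp
    moreover have "sign n M \<noteq> 0" using M assms(2) by auto
    ultimately have "prod_mset (Abs_multiset \<nu>) = prod_mset A" by simp
    then have "Abs_multiset \<nu> = A"
      using prime_polys_multiset_unique prod_power_eq_prod_mset(1)[OF 1] A(1) by blast
    then show "\<nu> = count A" using prod_power_eq_prod_mset(2)[OF 1] by simp
  qed
qed

end
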